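(* Let $\mathcal H=\mathbb C^d$ with orthonormal basis $\{|k\rangle\}_{k=1}^d$, $d<\infty$. Let $\mathsf{MultiPCov}$ be the monoid of multiphase covariant channels and $\mathsf{BPres}$ the monoid of basis-preserving channels on $M_d(\mathbb C)$. Then, with commutants taken inside the set of all quantum channels on $M_d(\mathbb C)$, $\mathsf{MultiPCov}'=\mathsf{BPres}$ and $\mathsf{BPres}'=\mathsf{MultiPCov}$.
   Context: For $\boldsymbol\theta=(\theta_1,\dots,\theta_d)\in[0,2\pi)^d$ let $U_{\boldsymbol\theta}=\sum_k e^{i\theta_k}|k\rangle\langle k|$ and $\mathcal U_{\boldsymbol\theta}=U_{\boldsymbol\theta}\cdot U_{\boldsymbol\theta}^\dagger$. A quantum channel $\mathcal M$ is multiphase covariant if $\mathcal U_{\boldsymbol\theta}\circ\mathcal M=\mathcal M\circ\mathcal U_{\boldsymbol\theta}$ for all $\boldsymbol\theta$. A channel $\mathcal B$ is basis-preserving if $\mathcal B(|k\rangle\langle k|)=|k\rangle\langle k|$ for all $k$. The commutant of a set of channels is the set of channels commuting under composition with each of its elements. *)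

theory Defs
  imports "HOL-Analysis.Analysis"
begin

text \<open>Operators on H = C^d are d x d complex matrices, indexed by a finite type 'd
  (the orthonormal basis |k> is indexed by k :: 'd).\<close>

type_synonym 'd cmat = "complex ^ 'd ^ 'd"

definition adj :: "'d::finite cmat \<Rightarrow> 'd cmat" where
  "adj A = (\<chi> i j. cnj (A $ j $ i))"

text \<open>Quantum channel (CPTP map) on M_d(C), given by a Kraus representation.\<close>
definition quantum_channel :: "('d::finite cmat \<Rightarrow> 'd cmat) \<Rightarrow> bool" where
  "quantum_channel \<Phi> \<longleftrightarrow>
     (\<exists>Ks :: 'd cmat list.
        sum_list (map (\<lambda>K. adj K ** K) Ks) = mat 1 \<and>
        (\<forall>X. \<Phi> X = sum_list (map (\<lambda>K. K ** X ** adj K) Ks)))"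

definition ketbra :: "'d::finite \<Rightarrow> 'd cmat" where
  "ketbra k = (\<chi> i j. if i = k \<and> j = k then 1 else 0)"

definition phase_unitary :: "('d::finite \<Rightarrow> real) \<Rightarrow> 'd cmat" where
  "phase_unitary \<theta> = (\<chi> i j. if i = j then cis (\<theta> i) else 0)"

definition phase_channel :: "('d::finite \<Rightarrow> real) \<Rightarrow> 'd cmat \<Rightarrow> 'd cmat" where
  "phase_channel \<theta> X = phase_unitary \<theta> ** X ** adj (phase_unitary \<theta>)"

definition MultiPCov :: "('d::finite cmat \<Rightarrow> 'd cmat) set" where
  "MultiPCov = {M. quantum_channel M \<and>
     (\<forall>\<theta>. (\<forall>k. \<theta> k \<in> {0..<2*pi}) \<longrightarrow> phase_channel \<theta> \<circ> M = M \<circ> phase_channel \<theta>)}"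

definition BPres :: "('d::finite cmat \<Rightarrow> 'd cmat) set" where
  "BPres = {B. quantum_channel B \<and> (\<forall>k. B (ketbra k) = ketbra k)}"

definition commutant :: "('d::finite cmat \<Rightarrow> 'd cmat) set \<Rightarrow> ('d cmat \<Rightarrow> 'd cmat) set" where
  "commutant S = {N. quantum_channel N \<and> (\<forall>M\<in>S. N \<circ> M = M \<circ> N)}"

end

theory Submission
  imports Defs
begin

text \<open>A channel is encoded by the coefficients T i j a b through which the (a, b) entry of the
  input contributes to the (i, j) entry of the output. The Kraus operators of a basis-preserving
  channel are diagonal, so such a channel is Schur multiplication by a matrix c with unit diagonal.
  Covariance forces T i j a b = 0 unless (a, b) = (i, j), or i = j and a = b; on these
  coefficients c i j = c a b, so both kinds of channels commute. Conversely, the phase channels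
  are basis-preserving, and the covariant channel replacing every state by the k-th basis state
  forces whatever commutes with it to fix that basis state.\<close>

section \<open>Coefficients of a channel in the basis of matrix units\<close>

definition matrix_unit :: "'d::finite \<Rightarrow> 'd \<Rightarrow> 'd cmat" where
  "matrix_unit k l = (\<chi> i j. if i = k \<and> j = l then 1 else 0)"

lemma ketbra_eq_matrix_unit: "ketbra k = matrix_unit k k"
  by (simp add: ketbra_def matrix_unit_def)

lemma sum_list_map_nth:
  fixes f :: "'a \<Rightarrow> 'b::comm_monoid_add ^ 'n"
  shows "sum_list (map f xs) $ i = sum_list (map (\<lambda>x. f x $ i) xs)"
  by (induction xs) simp_all

lemma conjugation_nth:
  "(K ** X ** adj K) $ i $ j =
     (\<Sum>a\<in>UNIV. \<Sum>b\<in>UNIV. K $ i $ a * cnj (K $ j $ b) * X $ a $ b)"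
proof -
  have "(K ** X ** adj K) $ i $ j =
     (\<Sum>b\<in>UNIV. \<Sum>a\<in>UNIV. K $ i $ a * cnj (K $ j $ b) * X $ a $ b)"
    unfolding matrix_matrix_mult_def adj_def
    by (simp add: sum_distrib_right) (simp add: mult_ac)
  also have "\<dots> = (\<Sum>a\<in>UNIV. \<Sum>b\<in>UNIV. K $ i $ a * cnj (K $ j $ b) * X $ a $ b)"
    by (rule sum.swap)
  finally show ?thesis .
qed

lemma sum_list_conjugation_nth:
  "sum_list (map (\<lambda>K. K ** X ** adj K) Ks) $ i $ j =
     (\<Sum>a\<in>UNIV. \<Sum>b\<in>UNIV.
        sum_list (map (\<lambda>K. K $ i $ a * cnj (K $ j $ b)) Ks) * X $ a $ b)"
  by (induction Ks) (simp_all add: conjugation_nth sum.distrib distrib_right)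

text \<open>Serves in two ways: it reads off one coefficient of an expansion, and it collapses a
  double sum once the summand has been rewritten as a multiple of a \<open>matrix_unit\<close>
  entry.\<close>

lemma sum_matrix_unit:
  fixes T :: "'d::finite \<Rightarrow> 'd \<Rightarrow> complex"
  shows "(\<Sum>a\<in>UNIV. \<Sum>b\<in>UNIV. T a b * matrix_unit k l $ a $ b) = T k l"
proof -
  have "T a b * matrix_unit k l $ a $ b = (if b = l then if a = k then T a b else 0 else 0)" for a b
    by (simp add: matrix_unit_def)
  then show ?thesis
    by simp
qed

lemma quantum_channel_nth:
  assumes "quantum_channel \<Phi>"
  shows "\<Phi> X $ i $ j = (\<Sum>a\<in>UNIV. \<Sum>b\<in>UNIV. \<Phi> (matrix_unit a b) $ i $ j * X $ a $ b)"
proof -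
  from assms obtain Ks where \<Phi>: "\<And>X. \<Phi> X = sum_list (map (\<lambda>K. K ** X ** adj K) Ks)"
    unfolding quantum_channel_def by blast
  show ?thesis
    unfolding \<Phi> sum_list_conjugation_nth sum_matrix_unit ..
qed

text \<open>Trace preservation, tested on matrix units: by the Kraus form, the trace of the image is
  the (l, k) entry of the normalization sum, which is \<open>mat 1\<close>.\<close>

lemma quantum_channel_trace:
  fixes \<Phi> :: "'d::finite cmat \<Rightarrow> 'd cmat"
  assumes "quantum_channel \<Phi>"
  shows "(\<Sum>i\<in>UNIV. \<Phi> (matrix_unit k l) $ i $ i) = (if k = l then 1 else 0)"
proof -
  from assms obtain Ks where \<Phi>: "\<And>X. \<Phi> X = sum_list (map (\<lambda>K. K ** X ** adj K) Ks)"
    and one: "sum_list (map (\<lambda>K. adj K ** K) Ks) = mat 1"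
    unfolding quantum_channel_def by blast
  have "(\<Sum>i\<in>UNIV. \<Phi> (matrix_unit k l) $ i $ i) =
      (\<Sum>i\<in>UNIV. sum_list (map (\<lambda>K. K $ i $ k * cnj (K $ i $ l)) Ks))"
    unfolding \<Phi> sum_list_conjugation_nth sum_matrix_unit ..
  also have "\<dots> = sum_list (map (\<lambda>K. \<Sum>i\<in>UNIV. K $ i $ k * cnj (K $ i $ l)) Ks)"
    by (induction Ks) (simp_all add: sum.distrib)
  also have "\<dots> = sum_list (map (\<lambda>K. adj K ** K) Ks) $ l $ k"
    by (simp add: sum_list_map_nth matrix_matrix_mult_def adj_def mult.commute)
  also have "\<dots> = (if k = l then 1 else 0)"
    unfolding one by (auto simp: mat_def)
  finally show ?thesis .
qed

section \<open>Basis-preserving channels as Schur multipliers\<close>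

lemma BPres_Schur:
  fixes B :: "'d::finite cmat \<Rightarrow> 'd cmat"
  assumes "B \<in> BPres"
  obtains c where "\<And>X i j. B X $ i $ j = c i j * X $ i $ j" "\<And>i. c i i = 1"
proof -
  from assms have B: "\<And>k. B (matrix_unit k k) = matrix_unit k k" and "quantum_channel B"
    by (auto simp: BPres_def ketbra_eq_matrix_unit)
  then obtain Ks where Ks: "\<And>X. B X = sum_list (map (\<lambda>K. K ** X ** adj K) Ks)"
    unfolding quantum_channel_def by blast
  have unit: "B (matrix_unit k l) $ i $ j = sum_list (map (\<lambda>K. K $ i $ k * cnj (K $ j $ l)) Ks)"
    for i j k l
    unfolding Ks sum_list_conjugation_nth sum_matrix_unit ..
  have diag: "K $ i $ k = 0" if "K \<in> set Ks" "i \<noteq> k" for K i k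
  proof -
    \<comment> \<open>The (i, i) entry of the image of the k-th basis state is a sum of squared
      moduli. It is 0 for \<open>i \<noteq> k\<close>, so every term vanishes.\<close>
    have "sum_list (map (\<lambda>K. K $ i $ k * cnj (K $ i $ k)) Ks) = 0"
      using unit[of k k i i, unfolded B] that(2) by (simp add: matrix_unit_def)
    moreover have "sum_list (map (\<lambda>K. K $ i $ k * cnj (K $ i $ k)) Ks) =
        of_real (sum_list (map (\<lambda>K. (cmod (K $ i $ k))\<^sup>2) Ks))"
      by (induction Ks) (simp_all add: complex_norm_square[symmetric])
    ultimately have "sum_list (map (\<lambda>K. (cmod (K $ i $ k))\<^sup>2) Ks) = 0"
      by simp
    then have "\<forall>x\<in>set (map (\<lambda>K. (cmod (K $ i $ k))\<^sup>2) Ks). x = 0"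
      by (subst (asm) sum_list_nonneg_eq_0_iff) auto
    then show ?thesis
      using that(1) by auto
  qed
  define c where "c i j = B (matrix_unit i j) $ i $ j" for i j
  \<comment> \<open>With diagonal Kraus operators a product of entries at (i, a) and (j, b) survives
    only for \<open>a = i\<close> and \<open>b = j\<close>.\<close>
  have off: "B (matrix_unit a b) $ i $ j = 0" if "\<not> (a = i \<and> b = j)" for a b i j
  proof -
    have "map (\<lambda>K. K $ i $ a * cnj (K $ j $ b)) Ks = map (\<lambda>K. 0) Ks"
      using that diag by auto
    then show ?thesis
      by (simp add: unit del: map_eq_conv)
  qed
  have "B X $ i $ j = c i j * X $ i $ j" for X i j
  proof -
    have "B (matrix_unit a b) $ i $ j * X $ a $ b =
        (c i j * X $ i $ j) * matrix_unit i j $ a $ b" for a b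
      using off[of a i b j] by (cases "a = i \<and> b = j") (auto simp: c_def matrix_unit_def)
    moreover have "B X $ i $ j = (\<Sum>a\<in>UNIV. \<Sum>b\<in>UNIV. B (matrix_unit a b) $ i $ j * X $ a $ b)"
      by (rule quantum_channel_nth) fact
    ultimately have "B X $ i $ j =
        (\<Sum>a\<in>UNIV. \<Sum>b\<in>UNIV. (c i j * X $ i $ j) * matrix_unit i j $ a $ b)"
      by (simp only:)
    also have "\<dots> = c i j * X $ i $ j"
      by (rule sum_matrix_unit)
    finally show ?thesis .
  qed
  moreover have "c i i = 1" for i
    by (simp add: c_def B) (simp add: matrix_unit_def)
  ultimately show ?thesis
    using that by blast
qed

section \<open>Phase channels and covariance\<close>

lemma phase_channel_nth:
  "phase_channel \<theta> X $ i $ j = cis (\<theta> i) * cnj (cis (\<theta> j)) * X $ i $ j"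
proof -
  have "phase_unitary \<theta> $ i $ a * cnj (phase_unitary \<theta> $ j $ b) * X $ a $ b =
      (cis (\<theta> i) * cnj (cis (\<theta> j)) * X $ i $ j) * matrix_unit i j $ a $ b" for a b
    by (auto simp: phase_unitary_def matrix_unit_def)
  then show ?thesis
    unfolding phase_channel_def conjugation_nth by (simp only: sum_matrix_unit)
qed

lemma phase_channel_BPres: "phase_channel \<theta> \<in> BPres"
proof -
  have "(adj (phase_unitary \<theta>) ** phase_unitary \<theta>) $ i $ j = mat 1 $ i $ j" for i j
  proof -
    have "adj (phase_unitary \<theta>) $ i $ a * phase_unitary \<theta> $ a $ j =
        (if a = i then if i = j then 1 else 0 else 0)" for a
      by (auto simp: adj_def phase_unitary_def cis_cnj cis_mult)
    then show ?thesis
      by (simp add: matrix_matrix_mult_def mat_def)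
  qed
  then have "adj (phase_unitary \<theta>) ** phase_unitary \<theta> = mat 1"
    by (simp add: vec_eq_iff)
  then have "quantum_channel (phase_channel \<theta>)"
    unfolding quantum_channel_def
    by (intro exI[of _ "[phase_unitary \<theta>]"]) (simp add: phase_channel_def)
  moreover have "phase_channel \<theta> (ketbra k) = ketbra k" for k
    by (auto simp: vec_eq_iff phase_channel_nth ketbra_def cis_cnj cis_mult)
  ultimately show ?thesis
    by (simp add: BPres_def)
qed

text \<open>Covariance equates the coefficient times the phase of (i, j) with the coefficient times
  the phase of (k, l). These two characters of the torus agree only in the two excluded
  cases.\<close>

lemma MultiPCov_coeff_eq_0:
  fixes M :: "'d::finite cmat \<Rightarrow> 'd cmat"
  assumes "M \<in> MultiPCov" and "\<not> (k = i \<and> l = j)" and "\<not> (k = l \<and> i = j)"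
  shows "M (matrix_unit k l) $ i $ j = 0"
proof -
  define T where "T = M (matrix_unit k l) $ i $ j"
  have eq: "cis (\<theta> i) * cnj (cis (\<theta> j)) * T = cis (\<theta> k) * cnj (cis (\<theta> l)) * T"
    if "\<And>k. \<theta> k \<in> {0..<2*pi}" for \<theta>
  proof -
    define z where "z = cis (\<theta> k) * cnj (cis (\<theta> l))"
    have M: "quantum_channel M" "phase_channel \<theta> \<circ> M = M \<circ> phase_channel \<theta>"
      using assms(1) that by (auto simp: MultiPCov_def)
    have "cis (\<theta> i) * cnj (cis (\<theta> j)) * T = M (phase_channel \<theta> (matrix_unit k l)) $ i $ j"
      using fun_cong[OF M(2), of "matrix_unit k l"] phase_channel_nth[of \<theta> "M (matrix_unit k l)" i j]
      by (simp add: T_def)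
    \<comment> \<open>The phase channel scales the matrix unit by \<open>z\<close>; expanding in
      coefficients lets \<open>z\<close> pass through \<open>M\<close>.\<close>
    also have "\<dots> = (\<Sum>a\<in>UNIV. \<Sum>b\<in>UNIV. (M (matrix_unit a b) $ i $ j * z) * matrix_unit k l $ a $ b)"
      unfolding quantum_channel_nth[OF M(1), of "phase_channel \<theta> (matrix_unit k l)"]
      by (intro sum.cong refl, unfold phase_channel_nth) (auto simp: matrix_unit_def z_def)
    also have "\<dots> = T * z"
      by (subst sum_matrix_unit) (simp add: T_def)
    finally show ?thesis
      by (simp add: z_def mult_ac)
  qed
  \<comment> \<open>Shifting a single phase by a quarter turn multiplies the two sides by different powers of
    the imaginary unit.\<close>
  have eq1: "(if i = m then \<i> else 1) * (if j = m then - \<i> else 1) * T =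
      (if k = m then \<i> else 1) * (if l = m then - \<i> else 1) * T" for m
  proof -
    have "cis (if x = m then pi / 2 else 0) = (if x = m then \<i> else 1)" for x
      by (simp add: cis_pi_half)
    moreover have "cnj (if x = m then \<i> else 1) = (if x = m then - \<i> else 1)" for x
      by simp
    ultimately show ?thesis
      using eq[of "\<lambda>x. if x = m then pi / 2 else 0"] by (simp only:) auto
  qed
  have "T = 0"
  proof (cases "k = l")
    case True
    \<comment> \<open>For \<open>k = l\<close> the factors on the right multiply to 1; on the left
      \<open>i \<noteq> j\<close> leaves only the imaginary unit.\<close>
    then have "\<i> * T = T"
      using eq1[of i] assms(3) by (auto split: if_splits)
    then show ?thesis
      by (simp add: complex_eq_iff)
  next
    case False
    \<comment> \<open>Shift the phase of an index at which the pairs differ: \<open>l\<close> if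
      \<open>k = i\<close>, since then \<open>l \<noteq> j\<close>, and \<open>k\<close>
      otherwise.\<close>
    show ?thesis
    proof (cases "k = i")
      case True
      then have "T = - \<i> * T \<or> \<i> * T = - \<i> * T"
        using eq1[of l] False assms(2) by (cases "i = l") auto
      then show ?thesis
        by (auto simp: complex_eq_iff)
    next
      case ki: False
      then have "T = \<i> * T \<or> - \<i> * T = \<i> * T"
        using eq1[of k] False by (cases "j = k") auto
      then show ?thesis
        by (auto simp: complex_eq_iff)
    qed
  qed
  then show ?thesis
    by (simp add: T_def)
qed

lemma MultiPCov_BPres_commute:
  fixes M :: "'d::finite cmat \<Rightarrow> 'd cmat"
  assumes "M \<in> MultiPCov" "B \<in> BPres"
  shows "M \<circ> B = B \<circ> M"
proof -
  obtain c where c: "\<And>X i j. B X $ i $ j = c i j * X $ i $ j" "\<And>i. c i i = 1"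
    using BPres_Schur[OF assms(2)] by blast
  have M: "quantum_channel M"
    using assms(1) by (simp add: MultiPCov_def)
  have "M (B X) $ i $ j = B (M X) $ i $ j" for X i j
  proof -
    \<comment> \<open>Where the coefficient survives, the multipliers are the same entry of
      \<open>c\<close>, or both lie on its diagonal and equal 1.\<close>
    have "M (matrix_unit a b) $ i $ j * B X $ a $ b = c i j * (M (matrix_unit a b) $ i $ j * X $ a $ b)"
      for a b
      using MultiPCov_coeff_eq_0[OF assms(1), of a i b j]
      by (cases "a = i \<and> b = j \<or> a = b \<and> i = j") (auto simp: c)
    then show ?thesis
      unfolding c(1)[of "M X"] quantum_channel_nth[OF M, of "B X"] quantum_channel_nth[OF M, of X]
        sum_distrib_left
      by (simp only:)
  qed
  then show ?thesis
    by (simp add: fun_eq_iff vec_eq_iff)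
qed

section \<open>Reset channels and the two commutants\<close>

definition reset_channel :: "'d::finite \<Rightarrow> 'd cmat \<Rightarrow> 'd cmat" where
  "reset_channel k X = (\<chi> i j. (\<Sum>l\<in>UNIV. X $ l $ l) * ketbra k $ i $ j)"

text \<open>The Kraus operators are the matrix units from each basis vector l to k. Covariance holds
  because phases change neither the diagonal of the input, hence its trace, nor the output basis
  state.\<close>

lemma reset_channel_MultiPCov:
  fixes k :: "'d::finite"
  shows "reset_channel k \<in> MultiPCov"
proof -
  obtain xs :: "'d list" where xs: "set xs = UNIV" "distinct xs"
    using finite_distinct_list[OF finite] by blast
  have sum_xs: "sum_list (map f xs) = sum f UNIV" for f :: "'d \<Rightarrow> complex"
    using xs by (simp add: sum_list_distinct_conv_sum_set)
  have "(adj (matrix_unit k l) ** matrix_unit k l) $ i $ j =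
      (if l = i then if i = j then 1 else 0 else 0)" for l i j
  proof -
    have "adj (matrix_unit k l) $ i $ a * matrix_unit k l $ a $ j =
        (if a = k then if l = i then if i = j then 1 else 0 else 0 else 0)" for a
      by (auto simp: adj_def matrix_unit_def)
    then show ?thesis
      by (simp add: matrix_matrix_mult_def)
  qed
  then have "sum_list (map (\<lambda>l. adj (matrix_unit k l) ** matrix_unit k l) xs) = mat 1"
    by (simp add: vec_eq_iff sum_list_map_nth sum_xs mat_def)
  moreover have "(matrix_unit k l ** X ** adj (matrix_unit k l)) $ i $ j =
      X $ l $ l * ketbra k $ i $ j" for l X i j
  proof -
    have "matrix_unit k l $ i $ a * cnj (matrix_unit k l $ j $ b) * X $ a $ b =
        (X $ l $ l * ketbra k $ i $ j) * matrix_unit l l $ a $ b" for a b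
      by (auto simp: matrix_unit_def ketbra_def)
    then show ?thesis
      unfolding conjugation_nth by (simp only: sum_matrix_unit)
  qed
  then have "reset_channel k X =
      sum_list (map (\<lambda>l. matrix_unit k l ** X ** adj (matrix_unit k l)) xs)" for X
    by (simp add: vec_eq_iff sum_list_map_nth sum_xs reset_channel_def sum_distrib_right)
  ultimately have "quantum_channel (reset_channel k)"
    unfolding quantum_channel_def
    by (intro exI[of _ "map (matrix_unit k) xs"]) (simp add: o_def)
  moreover have "phase_channel \<theta> \<circ> reset_channel k = reset_channel k \<circ> phase_channel \<theta>" for \<theta>
    by (auto simp: fun_eq_iff vec_eq_iff phase_channel_nth reset_channel_def ketbra_def cis_cnj cis_mult)
  ultimately show ?thesis
    by (simp add: MultiPCov_def)
qed

lemma commutant_MultiPCov_subset: "commutant MultiPCov \<subseteq> BPres"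
proof
  fix N :: "'d::finite cmat \<Rightarrow> 'd cmat"
  assume "N \<in> commutant MultiPCov"
  then have N: "quantum_channel N" and comm: "\<And>k. N \<circ> reset_channel k = reset_channel k \<circ> N"
    using reset_channel_MultiPCov by (auto simp: commutant_def)
  have "N (ketbra k) = ketbra k" for k
  proof -
    have "(\<Sum>l\<in>UNIV. ketbra k $ l $ l) = 1"
      by (simp add: ketbra_def)
    then have "reset_channel k (ketbra k) = ketbra k"
      by (simp add: vec_eq_iff reset_channel_def)
    \<comment> \<open>Since the reset fixes the basis state, commutation makes its image under
      \<open>N\<close> a multiple of that state; trace preservation makes the scalar 1.\<close>
    then have "N (ketbra k) = reset_channel k (N (ketbra k))"
      using fun_cong[OF comm, of k "ketbra k"] by simp
    also have "\<dots> = ketbra k"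
      using quantum_channel_trace[OF N, of k k]
      by (simp add: vec_eq_iff reset_channel_def ketbra_eq_matrix_unit)
    finally show ?thesis .
  qed
  with N show "N \<in> BPres"
    by (simp add: BPres_def)
qed

lemma commutant_BPres_subset: "commutant BPres \<subseteq> MultiPCov"
  unfolding commutant_def MultiPCov_def using phase_channel_BPres by (blast intro: sym)

theorem mainTheorem7:
  shows "commutant (MultiPCov :: ('d::finite cmat \<Rightarrow> 'd cmat) set) = BPres \<and>
         commutant (BPres :: ('d::finite cmat \<Rightarrow> 'd cmat) set) = MultiPCov"
proof (intro conjI equalityI commutant_MultiPCov_subset commutant_BPres_subset subsetI)
  \<comment> \<open>Both remaining inclusions are the one commutation lemma, read from either
    side.\<close>
  fix B :: "'d cmat \<Rightarrow> 'd cmat"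
  assume "B \<in> BPres"
  then show "B \<in> commutant MultiPCov"
    using MultiPCov_BPres_commute[of _ B] by (auto simp: commutant_def BPres_def)
next
  fix M :: "'d cmat \<Rightarrow> 'd cmat"
  assume "M \<in> MultiPCov"
  then show "M \<in> commutant BPres"
    using MultiPCov_BPres_commute[of M] by (auto simp: commutant_def MultiPCov_def)
qed

end
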